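(* There exists a sequence $(f_k(x,y))_k$ of polynomials of degree $4$ in $\mathbb{R}[x,y]$ such that $$\lim_{k\to+\infty}\frac{f_k^*-f_k^{\mathrm{SONC}}}{\Vert f_k\Vert}=+\infty .$$
   Context: For $f\in\mathbb{R}[x,y]$, $\Vert f\Vert$ denotes the supremum of the absolute values of the coefficients of $f$. For a finite set $\mathcal{A}\subset\mathbb{N}^n$ and $\beta\in\mathbb{N}^n\setminus\mathcal{A}$ (with $0\in\mathbb{N}$), $C_{\mathrm{AG}}(\mathcal{A},\beta)$ is the set of polynomials $\sum_{\alpha\in\mathcal{A}}c_\alpha x^\alpha+c_\beta x^\beta$ with $c_\alpha\ge 0$ for $\alpha\in\mathcal{A}$, $c_\beta\in\mathbb{R}$, $c_\gamma=0$ for all $\gamma\in\mathcal{A}\setminus(2\mathbb{N})^n$, that are nonnegative on $\mathbb{R}^n$. For a nonempty finite set $\mathcal{T}\subset\mathbb{N}^n$, $C_{\mathrm{SONC}}(\mathcal{T})=\sum_{\beta\in\mathcal{T}}C_{\mathrm{AG}}(\mathcal{T}\setminus\{\beta\},\beta)$ (Minkowski sum). Here $n=2$. For a polynomial $f$, $f^*$ is the infimum of $f$ over $\mathbb{R}^n$ and $f^{\mathrm{SONC}}=\sup\{\lambda\in\mathbb{R}: f-\lambda\in C_{\mathrm{SONC}}(\mathcal{T})\}$, where $\mathcal{T}$ is the set of exponents occurring in $f$ together with $0$. The sequence is understood to have finite values $f_k^*$ and $f_k^{\mathrm{SONC}}$. *)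

theory Defs
  imports "HOL-Analysis.Analysis" "HOL-Library.Poly_Mapping" "HOL-Library.Set_Algebras"
begin

text \<open>
  A real polynomial in variables indexed by the finite type \<open>'n\<close> is the finitely supported family of
  its coefficients, indexed by exponent vectors in \<open>nat ^ 'n\<close>. Thus \<open>Poly_Mapping.keys f\<close>
  is the set of exponents occurring in \<open>f\<close>, and \<open>Poly_Mapping.single 0 c\<close> is the
  constant polynomial \<open>c\<close>.
\<close>

type_synonym 'n rpoly = "(nat ^ 'n) \<Rightarrow>\<^sub>0 real"

definition poly_eval :: "'n::finite rpoly \<Rightarrow> real ^ 'n \<Rightarrow> real" where
  "poly_eval f x =
     (\<Sum>\<alpha>\<in>Poly_Mapping.keys f. Poly_Mapping.lookup f \<alpha> * (\<Prod>i\<in>UNIV. (x $ i) ^ (\<alpha> $ i)))"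

text \<open>Total degree; the zero polynomial gets degree 0.\<close>

definition total_degree :: "'n::finite rpoly \<Rightarrow> nat" where
  "total_degree f = Max (insert 0 ((\<lambda>\<alpha>. \<Sum>i\<in>UNIV. \<alpha> $ i) ` Poly_Mapping.keys f))"

definition coeff_norm :: "'n::finite rpoly \<Rightarrow> real" where
  "coeff_norm f = (SUP \<alpha>. \<bar>Poly_Mapping.lookup f \<alpha>\<bar>)"

definition even_exponent :: "nat ^ 'n::finite \<Rightarrow> bool" where
  "even_exponent \<alpha> \<longleftrightarrow> (\<forall>i. even (\<alpha> $ i))"

text \<open>Only meant for finite \<open>A\<close> and \<open>\<beta> \<notin> A\<close>.\<close>

definition C_AG :: "(nat ^ 'n::finite) set \<Rightarrow> nat ^ 'n \<Rightarrow> 'n rpoly set" where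
  "C_AG A \<beta> = {f. Poly_Mapping.keys f \<subseteq> insert \<beta> A
      \<and> (\<forall>\<alpha>\<in>A. Poly_Mapping.lookup f \<alpha> \<ge> 0)
      \<and> (\<forall>\<gamma>\<in>A. \<not> even_exponent \<gamma> \<longrightarrow> Poly_Mapping.lookup f \<gamma> = 0)
      \<and> (\<forall>x. poly_eval f x \<ge> 0)}"

text \<open>The sum below is one of sets, i.e. a Minkowski sum. Only meant for finite nonempty \<open>T\<close>.\<close>

definition C_SONC :: "(nat ^ 'n::finite) set \<Rightarrow> 'n rpoly set" where
  "C_SONC T = (\<Sum>\<beta>\<in>T. C_AG (T - {\<beta>}) \<beta>)"

text \<open>Both bounds are extended reals, so that an infinite value is visible as such.\<close>

definition poly_inf :: "'n::finite rpoly \<Rightarrow> ereal" where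
  "poly_inf f = (INF x. ereal (poly_eval f x))"

definition sonc_bound :: "'n::finite rpoly \<Rightarrow> ereal" where
  "sonc_bound f = Sup (ereal ` {c. f - Poly_Mapping.single 0 c \<in> C_SONC (insert 0 (Poly_Mapping.keys f))})"

end

theory Submission
  imports Defs
begin

text \<open>
  The gap comes from a frustration of signs. In an AG polynomial at most one exponent \<open>\<beta>\<close> carries a
  term that is not a nonnegative multiple of a square. If \<open>\<beta>\<close> is odd in some variable, then reflecting
  that variable flips the sign of this one term and of nothing else. So an AG polynomial remains
  nonnegative when the signs of its odd terms are chosen at will, and the same choice of signs can be
  made in all summands of a SONC polynomial at once (\<open>signed_eval_nonneg_C_SONC\<close>). Hence membership in
  the SONC cone cannot see any relation between the signs of the odd terms.

  The polynomial \<open>(x + y - 1)\<^sup>2 = x\<^sup>2 + y\<^sup>2 + 1 + 2xy - 2x - 2y\<close> is nonnegative only because of such a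
  relation: once the term \<open>2xy\<close> is replaced by \<open>- 2xy\<close>, its restriction to the diagonal \<open>x = y = t\<close> is
  \<open>1 - 4t\<close>, which is unbounded below, so no translate by a constant is SONC. Adding
  \<open>(x\<^sup>4 + y\<^sup>4) / t\<^sup>3\<close> makes the SONC bound finite and only halves the obstruction: at \<open>x = y = t\<close> the
  value with the changed sign becomes \<open>1 - 4t + 2t = 1 - 2t\<close>, which is therefore an upper bound for the
  SONC bound. Meanwhile the infimum stays in \<open>[0, 1]\<close> and the largest coefficient is \<open>2\<close> as soon as
  \<open>t \<ge> 1\<close>, so the normalized gap is at least \<open>(2t - 1) / 2\<close>.
\<close>

section \<open>Sign changes of odd terms\<close>

text \<open>
  The weight \<open>s\<close> rescales each term separately, so that polynomials with altered signs can be evaluated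
  by a functional that is linear in \<open>f\<close>.
\<close>

definition signed_eval :: "(nat ^ 'n::finite \<Rightarrow> real) \<Rightarrow> real ^ 'n \<Rightarrow> 'n rpoly \<Rightarrow> real" where
  "signed_eval s x f = (\<Sum>\<alpha>\<in>Poly_Mapping.keys f.
     Poly_Mapping.lookup f \<alpha> * (s \<alpha> * (\<Prod>i\<in>UNIV. (x $ i) ^ (\<alpha> $ i))))"

lemma poly_eval_eq_signed_eval: "poly_eval f x = signed_eval (\<lambda>_. 1) x f"
  by (simp add: poly_eval_def signed_eval_def)

lemma signed_eval_superset:
  assumes "finite S" "Poly_Mapping.keys f \<subseteq> S"
  shows "signed_eval s x f = (\<Sum>\<alpha>\<in>S.
     Poly_Mapping.lookup f \<alpha> * (s \<alpha> * (\<Prod>i\<in>UNIV. (x $ i) ^ (\<alpha> $ i))))"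
  unfolding signed_eval_def
  by (rule sum.mono_neutral_left) (use assms in \<open>auto simp: in_keys_iff\<close>)

lemma signed_eval_single [simp]:
  "signed_eval s x (Poly_Mapping.single \<alpha> c) = c * (s \<alpha> * (\<Prod>i\<in>UNIV. (x $ i) ^ (\<alpha> $ i)))"
  by (subst signed_eval_superset[of "{\<alpha>}"]) auto

lemma signed_eval_add [simp]:
  "signed_eval s x (f + g) = signed_eval s x f + signed_eval s x g"
proof -
  let ?S = "Poly_Mapping.keys f \<union> Poly_Mapping.keys g"
  have "Poly_Mapping.keys (f + g) \<subseteq> ?S"
    by (rule Poly_Mapping.keys_add)
  then show ?thesis
    by (simp add: signed_eval_superset[of ?S] lookup_add sum.distrib distrib_right)
qed

lemma signed_eval_diff [simp]:
  "signed_eval s x (f - g) = signed_eval s x f - signed_eval s x g"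
  using signed_eval_add[of s x "f - g" g] by simp

lemma signed_eval_sum:
  "signed_eval s x (\<Sum>i\<in>I. h i) = (\<Sum>i\<in>I. signed_eval s x (h i))"
  by (induction I rule: infinite_finite_induct) (auto simp: signed_eval_def[of s x 0])

text \<open>
  For odd \<open>\<beta>\<close>, let \<open>y\<close> be the reflection of \<open>x\<close> in a coordinate where \<open>\<beta>\<close> is odd. The \<open>\<beta>\<close>-terms at \<open>x\<close>
  and \<open>y\<close> are opposite and all other terms agree, so weighting the \<open>\<beta>\<close>-term by \<open>s \<beta> \<in> [- 1, 1]\<close> amounts
  to a convex combination of the two nonnegative values of \<open>f\<close>.
\<close>

lemma signed_eval_nonneg_C_AG:
  assumes f: "f \<in> C_AG A \<beta>"
    and s_even: "\<And>\<alpha>. even_exponent \<alpha> \<Longrightarrow> s \<alpha> = 1"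
    and s_le: "\<And>\<alpha>. \<bar>s \<alpha>\<bar> \<le> 1"
  shows "signed_eval s x f \<ge> 0"
proof -
  have nonneg: "poly_eval f z \<ge> 0" for z
    using f by (simp add: C_AG_def)
  have even_or_\<beta>: "even_exponent \<alpha> \<or> \<alpha> = \<beta>" if "\<alpha> \<in> Poly_Mapping.keys f" for \<alpha>
    using f that by (auto simp: C_AG_def in_keys_iff)
  show ?thesis
  proof (cases "even_exponent \<beta>")
    case True
    then have "signed_eval s x f = poly_eval f x"
      unfolding signed_eval_def poly_eval_def
      by (intro sum.cong refl) (use even_or_\<beta> s_even in fastforce)
    then show ?thesis
      using nonneg by simp
  next
    case False
    then obtain j where j: "odd (\<beta> $ j)"
      by (auto simp: even_exponent_def)
    define y where "y = (\<chi> i. if i = j then - x $ i else x $ i)"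
    have mono: "(\<Prod>i\<in>UNIV. (y $ i) ^ (\<alpha> $ i))
        = (if even (\<alpha> $ j) then 1 else - 1) * (\<Prod>i\<in>UNIV. (x $ i) ^ (\<alpha> $ i))" for \<alpha>
      by (simp add: y_def prod.remove[of UNIV j])
    have "signed_eval s x f
        = (1 + s \<beta>) / 2 * poly_eval f x + (1 - s \<beta>) / 2 * poly_eval f y"
      unfolding signed_eval_def poly_eval_def sum_distrib_left sum.distrib[symmetric]
    proof (intro sum.cong refl)
      fix \<alpha> assume "\<alpha> \<in> Poly_Mapping.keys f"
      from even_or_\<beta>[OF this]
      show "Poly_Mapping.lookup f \<alpha> * (s \<alpha> * (\<Prod>i\<in>UNIV. (x $ i) ^ (\<alpha> $ i)))
        = (1 + s \<beta>) / 2 * (Poly_Mapping.lookup f \<alpha> * (\<Prod>i\<in>UNIV. (x $ i) ^ (\<alpha> $ i)))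
        + (1 - s \<beta>) / 2 * (Poly_Mapping.lookup f \<alpha> * (\<Prod>i\<in>UNIV. (y $ i) ^ (\<alpha> $ i)))"
      proof
        assume "even_exponent \<alpha>"
        then show ?thesis
          by (simp add: mono s_even even_exponent_def field_simps)
      next
        assume "\<alpha> = \<beta>"
        then show ?thesis
          using j by (simp add: mono field_simps)
      qed
    qed
    moreover have "1 + s \<beta> \<ge> 0" "1 - s \<beta> \<ge> 0"
      using s_le[of \<beta>] by auto
    ultimately show ?thesis
      using nonneg by simp
  qed
qed

lemma signed_eval_nonneg_C_SONC:
  assumes "finite T" "f \<in> C_SONC T"
    and "\<And>\<alpha>. even_exponent \<alpha> \<Longrightarrow> s \<alpha> = 1" "\<And>\<alpha>. \<bar>s \<alpha>\<bar> \<le> 1"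
  shows "signed_eval s x f \<ge> 0"
proof -
  obtain h where "f = (\<Sum>\<beta>\<in>T. h \<beta>)" "\<forall>\<beta>\<in>T. h \<beta> \<in> C_AG (T - {\<beta>}) \<beta>"
    using assms(1,2) by (auto simp: C_SONC_def set_sum_alt)
  then show ?thesis
    using assms(3,4) by (auto simp: signed_eval_sum intro!: sum_nonneg signed_eval_nonneg_C_AG)
qed

lemma zero_in_C_AG: "0 \<in> C_AG A \<beta>"
  by (simp add: C_AG_def poly_eval_def)

text \<open>
  This allows a SONC decomposition to be given by its nonzero summands only.
\<close>

lemma sum_in_C_SONC:
  assumes "finite T" "S \<subseteq> T" "\<And>\<beta>. \<beta> \<in> S \<Longrightarrow> h \<beta> \<in> C_AG (T - {\<beta>}) \<beta>"
  shows "(\<Sum>\<beta>\<in>S. h \<beta>) \<in> C_SONC T"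
proof -
  define h' where "h' = (\<lambda>\<beta>. if \<beta> \<in> S then h \<beta> else 0)"
  have "(\<Sum>\<beta>\<in>S. h \<beta>) = (\<Sum>\<beta>\<in>T. h' \<beta>)"
    using assms(1,2) by (intro sum.mono_neutral_cong_left) (auto simp: h'_def)
  moreover have "h' \<beta> \<in> C_AG (T - {\<beta>}) \<beta>" for \<beta>
    using assms(3) by (simp add: h'_def zero_in_C_AG)
  ultimately show ?thesis
    using assms(1) by (auto simp: C_SONC_def set_sum_alt)
qed

section \<open>A family of quartics with growing gap\<close>

lemma prod_UNIV_2: "prod f (UNIV :: 2 set) = f 1 * f 2"
  by (simp add: UNIV_2)

definition expo :: "nat \<Rightarrow> nat \<Rightarrow> nat ^ 2" where
  "expo a b = vector [a, b]"

lemma expo_nth [simp]: "expo a b $ 1 = a" "expo a b $ 2 = b"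
  by (simp_all add: expo_def)

lemma expo_eq_iff [simp]: "expo a b = expo c d \<longleftrightarrow> a = c \<and> b = d"
  by (auto simp: vec_eq_iff forall_2)

lemma expo_eq_0_iff [simp]: "expo a b = 0 \<longleftrightarrow> a = 0 \<and> b = 0" "0 = expo a b \<longleftrightarrow> a = 0 \<and> b = 0"
  by (auto simp: vec_eq_iff forall_2)

lemma even_exponent_expo [simp]: "even_exponent (expo a b) \<longleftrightarrow> even a \<and> even b"
  by (simp add: even_exponent_def forall_2)

lemma even_exponent_0 [simp]: "even_exponent 0"
  by (simp add: even_exponent_def)

abbreviation monomial :: "nat \<Rightarrow> nat \<Rightarrow> real \<Rightarrow> 2 rpoly" where
  "monomial a b c \<equiv> Poly_Mapping.single (expo a b) c"

text \<open>
  This is \<open>(x + y - 1)\<^sup>2 + (x\<^sup>4 + y\<^sup>4) / t\<^sup>3\<close>, expanded into its terms. The weight \<open>1 / t\<^sup>3\<close> is the one for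
  which the quartic part is of the same order \<open>t\<close> as the linear part at \<open>x = y = t\<close>.
\<close>

definition gap_quartic :: "real \<Rightarrow> 2 rpoly" where
  "gap_quartic t = monomial 2 0 1 + monomial 0 2 1 + Poly_Mapping.single 0 1
     + monomial 1 1 2 + monomial 1 0 (- 2) + monomial 0 1 (- 2)
     + monomial 4 0 (1 / t ^ 3) + monomial 0 4 (1 / t ^ 3)"

lemma poly_eval_gap_quartic:
  "poly_eval (gap_quartic t) x = (x $ 1 + x $ 2 - 1)\<^sup>2 + ((x $ 1) ^ 4 + (x $ 2) ^ 4) / t ^ 3"
  by (simp add: poly_eval_eq_signed_eval gap_quartic_def prod_UNIV_2 power2_eq_square field_simps
      add_divide_distrib del: single_one)

lemma lookup_gap_quartic:
  "Poly_Mapping.lookup (gap_quartic t) \<alpha> =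
     (if \<alpha> \<in> {0, expo 2 0, expo 0 2} then 1
      else if \<alpha> = expo 1 1 then 2
      else if \<alpha> \<in> {expo 1 0, expo 0 1} then - 2
      else if \<alpha> \<in> {expo 4 0, expo 0 4} then 1 / t ^ 3
      else 0)"
  by (auto simp: gap_quartic_def lookup_add lookup_single when_def simp del: single_one)

lemma keys_gap_quartic:
  assumes "t > 0"
  shows "Poly_Mapping.keys (gap_quartic t) = {0, expo 2 0, expo 0 2, expo 1 1, expo 1 0, expo 0 1,
    expo 4 0, expo 0 4}"
  using assms by (auto simp: in_keys_iff lookup_gap_quartic split: if_splits)

lemma total_degree_gap_quartic: "t > 0 \<Longrightarrow> total_degree (gap_quartic t) = 4"
  by (simp add: total_degree_def keys_gap_quartic sum_2)

lemma coeff_norm_gap_quartic: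
  assumes "t \<ge> 1"
  shows "coeff_norm (gap_quartic t) = 2"
proof -
  have "1 / t ^ 3 \<le> 1"
    using assms by (simp add: one_le_power)
  then have "1 / t ^ 3 \<le> 2"
    by linarith
  then have le: "\<bar>Poly_Mapping.lookup (gap_quartic t) \<alpha>\<bar> \<le> 2" for \<alpha>
    using assms by (auto simp: lookup_gap_quartic)
  show ?thesis
    unfolding coeff_norm_def
  proof (rule cSup_eq_maximum)
    show "2 \<in> range (\<lambda>\<alpha>. \<bar>Poly_Mapping.lookup (gap_quartic t) \<alpha>\<bar>)"
      by (rule range_eqI[of _ _ "expo 1 1"]) (simp add: lookup_gap_quartic)
  qed (use le in auto)
qed

lemma poly_inf_gap_quartic:
  assumes "t > 0"
  shows "0 \<le> poly_inf (gap_quartic t)" "poly_inf (gap_quartic t) \<le> 1"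
proof -
  show "0 \<le> poly_inf (gap_quartic t)"
    unfolding poly_inf_def using assms by (intro INF_greatest) (simp add: poly_eval_gap_quartic)
  have "poly_inf (gap_quartic t) \<le> ereal (poly_eval (gap_quartic t) 0)"
    unfolding poly_inf_def by (rule INF_lower) simp
  then show "poly_inf (gap_quartic t) \<le> 1"
    by (simp add: poly_eval_gap_quartic one_ereal_def)
qed

text \<open>
  The sign of \<open>2xy\<close> is reversed, which makes all odd terms negative at the point \<open>(t, t)\<close>.
\<close>

lemma sonc_bound_gap_quartic_le:
  assumes "t > 0"
  shows "sonc_bound (gap_quartic t) \<le> ereal (1 - 2 * t)"
  unfolding sonc_bound_def
proof (rule Sup_least, clarsimp)
  fix c
  assume "gap_quartic t - Poly_Mapping.single 0 c \<in> C_SONC (insert 0 (Poly_Mapping.keys (gap_quartic t)))"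
  then have "0 \<le> signed_eval (\<lambda>\<alpha>. if \<alpha> = expo 1 1 then - 1 else 1) (vec t)
      (gap_quartic t - Poly_Mapping.single 0 c)"
    by (rule signed_eval_nonneg_C_SONC[rotated]) auto
  also have "\<dots> = 1 - c - 4 * t + 2 * (t ^ 4 / t ^ 3)"
    by (simp add: gap_quartic_def prod_UNIV_2 vec_def power2_eq_square field_simps del: single_one)
  also have "t ^ 4 / t ^ 3 = t"
    using assms by (simp add: field_simps eval_nat_numeral)
  finally show "c \<le> 1 - 2 * t"
    by simp
qed

text \<open>
  With \<open>x = t u\<close> the claim becomes \<open>t (u\<^sup>4 - 2u + 2) \<ge> 0\<close>, and \<open>u\<^sup>4 - 2u + 2\<close> is a sum of squares.
\<close>

lemma quartic_minus_linear_nonneg: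
  fixes t x :: real
  assumes "t > 0"
  shows "0 \<le> x ^ 4 / t ^ 3 - 2 * x + 2 * t"
proof -
  define u where "u = x / t"
  have x: "x = t * u"
    using assms by (simp add: u_def)
  have "x ^ 4 / t ^ 3 - 2 * x + 2 * t = t * ((u\<^sup>2 - 1)\<^sup>2 + (u - 1)\<^sup>2 + u\<^sup>2)"
    using assms by (simp add: x field_simps eval_nat_numeral)
  also have "\<dots> \<ge> 0"
    using assms by simp
  finally show ?thesis .
qed

text \<open>
  Some lower bound is required for the SONC bound to be finite. One AG summand serves each odd term:
  the squares pay for \<open>2xy\<close>, while each linear term is paid for by a pure fourth power together with a
  constant \<open>2t\<close>. The constants add up to \<open>4t\<close>, whence \<open>1 - 4t\<close>.
\<close>

lemma sonc_bound_gap_quartic_ge: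
  assumes "t > 0"
  shows "ereal (1 - 4 * t) \<le> sonc_bound (gap_quartic t)"
proof -
  define h where "h = (\<lambda>\<beta>.
    if \<beta> = expo 1 1 then monomial 2 0 1 + monomial 1 1 2 + monomial 0 2 1
    else if \<beta> = expo 1 0 then monomial 4 0 (1 / t ^ 3) + monomial 1 0 (- 2) + Poly_Mapping.single 0 (2 * t)
    else monomial 0 4 (1 / t ^ 3) + monomial 0 1 (- 2) + Poly_Mapping.single 0 (2 * t))"
  let ?T = "insert 0 (Poly_Mapping.keys (gap_quartic t))"
  let ?S = "{expo 1 1, expo 1 0, expo 0 1}"
  have "gap_quartic t - Poly_Mapping.single 0 (1 - 4 * t) = (\<Sum>\<beta>\<in>?S. h \<beta>)"
  proof (rule poly_mapping_eqI)
    fix \<alpha>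
    have "Poly_Mapping.lookup (\<Sum>\<beta>\<in>?S. h \<beta>) \<alpha> = Poly_Mapping.lookup (h (expo 1 1)) \<alpha>
        + Poly_Mapping.lookup (h (expo 1 0)) \<alpha> + Poly_Mapping.lookup (h (expo 0 1)) \<alpha>"
      by (simp add: lookup_add)
    then show "Poly_Mapping.lookup (gap_quartic t - Poly_Mapping.single 0 (1 - 4 * t)) \<alpha>
        = Poly_Mapping.lookup (\<Sum>\<beta>\<in>?S. h \<beta>) \<alpha>"
      by (auto simp: h_def gap_quartic_def lookup_add lookup_minus lookup_single when_def
          simp del: single_one)
  qed
  also have "\<dots> \<in> C_SONC ?T"
  proof (rule sum_in_C_SONC)
    fix \<beta> assume "\<beta> \<in> ?S"
    moreover have "h (expo 1 1) \<in> C_AG (?T - {expo 1 1}) (expo 1 1)"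
    proof -
      have "0 \<le> poly_eval (h (expo 1 1)) x" for x
        using zero_le_power2[of "x $ 1 + x $ 2"]
        by (simp add: h_def poly_eval_eq_signed_eval prod_UNIV_2 power2_sum)
      moreover have "Poly_Mapping.keys (h (expo 1 1)) \<subseteq> ?T"
        by (auto simp: h_def keys_gap_quartic assms in_keys_iff lookup_add lookup_single when_def
            split: if_splits)
      ultimately show ?thesis
        by (auto simp: C_AG_def h_def lookup_add lookup_single when_def)
    qed
    moreover have "h (expo 1 0) \<in> C_AG (?T - {expo 1 0}) (expo 1 0)"
    proof -
      have "0 \<le> poly_eval (h (expo 1 0)) x" for x
        using quartic_minus_linear_nonneg[OF assms, of "x $ 1"]
        by (simp add: h_def poly_eval_eq_signed_eval prod_UNIV_2)
      moreover have "Poly_Mapping.keys (h (expo 1 0)) \<subseteq> ?T"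
        by (auto simp: h_def keys_gap_quartic assms in_keys_iff lookup_add lookup_single when_def
            split: if_splits)
      ultimately show ?thesis
        using assms by (auto simp: C_AG_def h_def lookup_add lookup_single when_def)
    qed
    moreover have "h (expo 0 1) \<in> C_AG (?T - {expo 0 1}) (expo 0 1)"
    proof -
      have "0 \<le> poly_eval (h (expo 0 1)) x" for x
        using quartic_minus_linear_nonneg[OF assms, of "x $ 2"]
        by (simp add: h_def poly_eval_eq_signed_eval prod_UNIV_2)
      moreover have "Poly_Mapping.keys (h (expo 0 1)) \<subseteq> ?T"
        by (auto simp: h_def keys_gap_quartic assms in_keys_iff lookup_add lookup_single when_def
            split: if_splits)
      ultimately show ?thesis
        using assms by (auto simp: C_AG_def h_def lookup_add lookup_single when_def)
    qed
    ultimately show "h \<beta> \<in> C_AG (?T - {\<beta>}) \<beta>"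
      by auto
  qed (auto simp: keys_gap_quartic assms)
  finally show ?thesis
    unfolding sonc_bound_def by (intro Sup_upper) auto
qed

theorem corollary4p8:
  shows "\<exists>f :: nat \<Rightarrow> 2 rpoly.
    (\<forall>k. total_degree (f k) = 4 \<and> \<bar>poly_inf (f k)\<bar> \<noteq> \<infinity> \<and> \<bar>sonc_bound (f k)\<bar> \<noteq> \<infinity>) \<and>
    filterlim (\<lambda>k. (real_of_ereal (poly_inf (f k)) - real_of_ereal (sonc_bound (f k))) / coeff_norm (f k))
      at_top sequentially"
proof (intro exI conjI allI)
  let ?f = "\<lambda>k. gap_quartic (real (Suc k))"
  fix k
  show "total_degree (?f k) = 4"
    by (rule total_degree_gap_quartic) simp
  show inf: "\<bar>poly_inf (?f k)\<bar> \<noteq> \<infinity>" for k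
    using poly_inf_gap_quartic[of "real (Suc k)"] by (cases "poly_inf (?f k)") auto
  show sonc: "\<bar>sonc_bound (?f k)\<bar> \<noteq> \<infinity>" for k
    using sonc_bound_gap_quartic_ge[of "real (Suc k)"] sonc_bound_gap_quartic_le[of "real (Suc k)"]
    by (cases "sonc_bound (?f k)") auto
  have "real k \<le> (real_of_ereal (poly_inf (?f k)) - real_of_ereal (sonc_bound (?f k)))
      / coeff_norm (?f k)" for k
    using poly_inf_gap_quartic(1)[of "real (Suc k)"] sonc_bound_gap_quartic_le[of "real (Suc k)"]
      inf[of k] sonc[of k]
    by (cases "poly_inf (?f k)"; cases "sonc_bound (?f k)") (auto simp: coeff_norm_gap_quartic)
  then show "filterlim (\<lambda>k. (real_of_ereal (poly_inf (?f k)) - real_of_ereal (sonc_bound (?f k)))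
      / coeff_norm (?f k)) at_top sequentially"
    by (intro filterlim_at_top_mono[OF filterlim_real_sequentially] always_eventually) auto
qed

end
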